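(* Let $T>0$, $\sigma\in\mathbb{R}$ and $\phi\in H^\sigma(\mathbb{T};\mathbb{R})$, and consider the heat equation with one scalar control $$\partial_tu-\Delta u=v(t)\phi \ \text{ on } (0,T)\times\mathbb{T},\qquad u|_{t=0}=u_0,\qquad v\in L^2((0,T);\mathbb{R}).$$ This system is not controllable in time $T$, in the following sense. (i) If $\langle\phi,e^{in_0x}\rangle=0$ for some $n_0\in\mathbb{Z}$, then the control has no effect on the mode $e^{in_0x}$: for every $v$, $\langle u(T,\cdot),e^{in_0x}\rangle=e^{-n_0^2T}\langle u_0,e^{in_0x}\rangle$. (ii) If $\langle\phi,e^{inx}\rangle\ne0$ for all $n\in\mathbb{Z}$, then with $d_n:=\langle\phi,e^{inx}\rangle/\langle\phi,e^{-inx}\rangle$, every state $u(T,\cdot)$ reached at time $T$ from $u_0=0$ satisfies $$\langle u(T,\cdot),e^{inx}\rangle=d_n\langle u(T,\cdot),e^{-inx}\rangle,\qquad\forall n\ge1;$$ consequently, for each $n\ge1$, the projection of the set of states reachable from $0$ at time $T$ onto the two-dimensional space $\mathrm{Span}\{e^{inx},e^{-inx}\}$ is one-dimensional.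
   Context: $\mathbb{T}=\mathbb{R}/2\pi\mathbb{Z}$, $\Delta=\partial_x^2$, so $\Delta e^{inx}=-n^2e^{inx}$. $\langle f,e^{inx}\rangle$ denotes the $n$-th Fourier coefficient (pairing of $f$ with $e^{inx}$, conjugate-linear in the second slot). The solution is given mode by mode by Duhamel's formula: $\langle u(T,\cdot),e^{inx}\rangle=e^{-n^2T}\langle u_0,e^{inx}\rangle+\langle\phi,e^{inx}\rangle\int_0^Te^{-n^2(T-s)}v(s)\,ds$. *)

theory Defs
  imports "HOL-Analysis.Analysis" "HOL-Library.Function_Algebras"
begin

section \<open>Periodic distributions\<close>

text \<open>Functions on the torus are functions on the real line of period \<open>2\<pi>\<close>.\<close>

definition iter_deriv :: "nat \<Rightarrow> (real \<Rightarrow> complex) \<Rightarrow> real \<Rightarrow> complex" where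
  "iter_deriv k f = ((\<lambda>g x. vector_derivative g (at x)) ^^ k) f"

definition test_function :: "(real \<Rightarrow> complex) \<Rightarrow> bool" where
  "test_function f \<longleftrightarrow>
     (\<forall>x. f (x + 2 * pi) = f x) \<and> (\<forall>k x. iter_deriv k f differentiable (at x))"

type_synonym dist = "(real \<Rightarrow> complex) \<Rightarrow> complex"

text \<open>A distribution is a complex-linear functional on the test functions, continuous for the
  usual Frechet topology; its values outside the test functions are irrelevant.\<close>

definition periodic_distribution :: "dist \<Rightarrow> bool" where
  "periodic_distribution w \<longleftrightarrow>
     (\<forall>f g. test_function f \<longrightarrow> test_function g \<longrightarrow> w (\<lambda>x. f x + g x) = w f + w g) \<and>
     (\<forall>c f. test_function f \<longrightarrow> w (\<lambda>x. c * f x) = c * w f) \<and>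
     (\<exists>N C. \<forall>f. test_function f \<longrightarrow>
        norm (w f) \<le> C * (\<Sum>k\<le>N. SUP x. norm (iter_deriv k f x)))"

definition real_distribution :: "dist \<Rightarrow> bool" where
  "real_distribution w \<longleftrightarrow> periodic_distribution w \<and>
     (\<forall>f. test_function f \<longrightarrow> (\<forall>x. f x \<in> \<real>) \<longrightarrow> w f \<in> \<real>)"

definition fexp :: "int \<Rightarrow> real \<Rightarrow> complex" where
  "fexp n x = exp (\<i> * of_int n * of_real x)"

text \<open>An integrable function \<open>h\<close> is identified with the functional
  \<open>f \<mapsto> (1/2\<pi>) \<integral> h f\<close> over a period; with this normalisation the pairing
  below is the usual Fourier coefficient.\<close>

definition pairing :: "dist \<Rightarrow> (real \<Rightarrow> complex) \<Rightarrow> complex" where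
  "pairing w f = w (\<lambda>x. cnj (f x))"

abbreviation fourier :: "dist \<Rightarrow> int \<Rightarrow> complex" where
  "fourier w n \<equiv> pairing w (fexp n)"

definition sobolev_real :: "real \<Rightarrow> dist set" where
  "sobolev_real \<sigma> = {w. real_distribution w \<and>
     (\<lambda>n::int. (1 + (of_int n)\<^sup>2) powr \<sigma> * (norm (fourier w n))\<^sup>2) summable_on UNIV}"


section \<open>The controlled heat equation\<close>

definition controls :: "real \<Rightarrow> (real \<Rightarrow> real) set" where
  "controls T = {v. v \<in> borel_measurable (lebesgue_on {0<..<T}) \<and>
     integrable (lebesgue_on {0<..<T}) (\<lambda>t. (v t)\<^sup>2)}"

text \<open>Solutions of \<open>\<partial>\<^sub>t u - \<Delta> u = v \<phi>\<close>, \<open>u(0) = u0\<close> on the time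
  interval \<open>[0, T]\<close>, given mode by mode by Duhamel's formula.\<close>

definition heat_solution ::
  "real \<Rightarrow> dist \<Rightarrow> (real \<Rightarrow> real) \<Rightarrow> dist \<Rightarrow> (real \<Rightarrow> dist) \<Rightarrow> bool" where
  "heat_solution T \<phi> v u0 u \<longleftrightarrow>
     (\<forall>t\<in>{0..T}. periodic_distribution (u t) \<and>
        (\<forall>n. fourier (u t) n =
           of_real (exp (- (of_int n)\<^sup>2 * t)) * fourier u0 n +
           fourier \<phi> n *
             of_real (LINT s|lebesgue_on {0<..<t}. exp (- (of_int n)\<^sup>2 * (t - s)) * v s)))"

definition reachable_from_zero :: "real \<Rightarrow> dist \<Rightarrow> dist set" where
  "reachable_from_zero T \<phi> =
     {u T | u v. v \<in> controls T \<and> heat_solution T \<phi> v (\<lambda>f. 0) u}"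


section \<open>Projection onto a pair of modes\<close>

abbreviation scale_real :: "real \<Rightarrow> (real \<Rightarrow> complex) \<Rightarrow> real \<Rightarrow> complex" where
  "scale_real r f \<equiv> (\<lambda>x. of_real r * f x)"

abbreviation scale_complex :: "complex \<Rightarrow> (real \<Rightarrow> complex) \<Rightarrow> real \<Rightarrow> complex" where
  "scale_complex c f \<equiv> (\<lambda>x. c * f x)"

definition mode_space :: "int \<Rightarrow> (real \<Rightarrow> complex) set" where
  "mode_space n = module.span scale_complex {fexp n, fexp (- n)}"

definition mode_projection :: "int \<Rightarrow> dist \<Rightarrow> real \<Rightarrow> complex" where
  "mode_projection n w = (\<lambda>x. fourier w n * fexp n x + fourier w (- n) * fexp (- n) x)"

end

theory Submission
  imports Defs
begin

text \<open>
  The Duhamel multiplier of the mode \<open>n\<close> depends only on \<open>n\<^sup>2\<close>, so a control acts on the modes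
  \<open>n\<close> and \<open>- n\<close> by one common real factor: the projection of the reachable set lies on the real
  line through the projection of \<open>\<phi>\<close>. Constant controls already fill that line, since their factor
  is a nonzero multiple of the constant. That they do reach a distribution is seen by
  summing the Fourier series: coefficients of polynomial growth always define one, because the
  coefficients of a test function decay rapidly.
\<close>

section \<open>Test functions\<close>

lemma iter_deriv_0 [simp]: "iter_deriv 0 f = f"
  by (simp add: iter_deriv_def)

text \<open>Peeling off the innermost derivative, where \<open>funpow\<close> peels off the
  outermost, lets an induction on \<open>k\<close> with \<open>f\<close> arbitrary pass from
  \<open>f\<close> to its derivative.\<close>

lemma iter_deriv_Suc:
  "iter_deriv (Suc k) f = iter_deriv k (\<lambda>x. vector_derivative f (at x))"
  by (simp add: iter_deriv_def funpow_Suc_right del: funpow.simps)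

lemma test_function_periodic: "test_function f \<Longrightarrow> f (x + 2 * pi) = f x"
  by (simp add: test_function_def)

lemma test_function_differentiable: "test_function f \<Longrightarrow> f differentiable (at x)"
  unfolding test_function_def by (metis iter_deriv_0)

lemma test_function_has_vector_derivative:
  "test_function f \<Longrightarrow> (f has_vector_derivative vector_derivative f (at x)) (at x)"
  using test_function_differentiable vector_derivative_works by blast

lemma test_function_continuous_on: "test_function f \<Longrightarrow> continuous_on S f"
  by (meson continuous_at_imp_continuous_on differentiable_imp_continuous_within
      test_function_differentiable)

text \<open>The chain rule for the shift by one period transfers periodicity; smoothness is a shift
  of the index \<open>k\<close>.\<close>

lemma test_function_vector_derivative:
  assumes "test_function f"
  shows "test_function (\<lambda>x. vector_derivative f (at x))"
proof -
  have "vector_derivative f (at (x + 2 * pi)) = vector_derivative f (at x)" for x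
  proof -
    have "((\<lambda>y. y + 2 * pi) has_vector_derivative 1) (at x)"
      by (auto intro!: derivative_eq_intros)
    from vector_diff_chain_at[OF this test_function_has_vector_derivative[OF assms]]
    have "(f \<circ> (\<lambda>y. y + 2 * pi) has_vector_derivative vector_derivative f (at (x + 2 * pi))) (at x)"
      by simp
    moreover have "f \<circ> (\<lambda>y. y + 2 * pi) = f"
      using test_function_periodic[OF assms] by auto
    ultimately show ?thesis
      by (simp add: vector_derivative_at)
  qed
  moreover have "iter_deriv k (\<lambda>x. vector_derivative f (at x)) differentiable (at x)" for k x
    using assms unfolding test_function_def iter_deriv_Suc[symmetric] by blast
  ultimately show ?thesis
    unfolding test_function_def by blast
qed

lemma test_function_iter_deriv: "test_function f \<Longrightarrow> test_function (iter_deriv k f)"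
  by (induction k arbitrary: f) (simp_all add: iter_deriv_Suc test_function_vector_derivative)

text \<open>By periodicity all values are taken on one compact period.\<close>

lemma bounded_range_test_function:
  assumes "test_function f"
  shows "bounded (range f)"
proof -
  have "range f \<subseteq> f ` {0..2 * pi}"
  proof clarify
    fix x :: real
    define k where "k = \<lfloor>x / (2 * pi)\<rfloor>"
    have per: "f (y + 2 * pi * real m) = f y" for y m
    proof (induction m)
      case (Suc m)
      have "f (y + 2 * pi * real (Suc m)) = f ((y + 2 * pi * real m) + 2 * pi)"
        by (simp add: algebra_simps)
      then show ?case
        using Suc test_function_periodic[OF assms] by simp
    qed simp
    have "f (x - 2 * pi * of_int k) = f x"
    \<comment> \<open>\<open>per\<close> only shifts forward, so it starts from the translated point
      if \<open>k\<close> is nonnegative and from \<open>x\<close> otherwise.\<close>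
    proof (cases "k \<ge> 0")
      case True
      then show ?thesis
        using per[of "x - 2 * pi * of_int k" "nat k"] by simp
    next
      case False
      then show ?thesis
        using per[of x "nat (- k)"] by simp
    qed
    moreover have "x - 2 * pi * of_int k \<in> {0..2 * pi}"
    proof -
      have "of_int k \<le> x / (2 * pi)" "x / (2 * pi) < of_int k + 1"
        unfolding k_def by linarith+
      then show ?thesis
        by (simp add: field_simps)
    qed
    ultimately show "f x \<in> f ` {0..2 * pi}"
      by (metis imageI)
  qed
  moreover have "bounded (f ` {0..2 * pi})"
    using assms by (intro compact_imp_bounded compact_continuous_image test_function_continuous_on) auto
  ultimately show ?thesis
    by (rule bounded_subset[rotated])
qed

text \<open>A real \<open>SUP\<close> is known to dominate only when the range is bounded above,
  which compactness of the period provides.\<close>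

lemma norm_test_function_le_SUP:
  assumes "test_function f"
  shows "norm (f x) \<le> (SUP y. norm (f y))"
proof (rule cSUP_upper)
  obtain B where "\<And>y. norm (f y) \<le> B"
    using bounded_range_test_function[OF assms] unfolding bounded_iff by auto
  then show "bdd_above (range (\<lambda>y. norm (f y)))"
    by (intro bdd_aboveI2)
qed simp

section \<open>The exponentials as test functions\<close>

lemma cnj_fexp: "cnj (fexp n x) = fexp (- n) x"
  by (simp add: fexp_def exp_cnj)

lemma norm_fexp [simp]: "norm (fexp n x) = 1"
  by (simp add: fexp_def)

lemma fexp_mult: "fexp m x * fexp n x = fexp (m + n) x"
  by (simp add: fexp_def exp_add[symmetric] algebra_simps)

lemma fexp_periodic: "fexp n (x + 2 * pi) = fexp n x"
proof -
  have "fexp n (x + 2 * pi) = fexp n x * exp (2 * of_int n * of_real pi * \<i>)"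
    by (simp add: fexp_def exp_add[symmetric] algebra_simps)
  also have "exp (2 * of_int n * of_real pi * \<i>) = 1"
    by (simp add: exp_eq_1)
  finally show ?thesis
    by simp
qed

lemma fexp_has_vector_derivative:
  "(fexp n has_vector_derivative (\<i> * of_int n * fexp n x)) (at x within S)"
  unfolding fexp_def
  by (rule has_vector_derivative_real_field) (auto intro!: derivative_eq_intros)

text \<open>The free scalar \<open>c\<close> absorbs the factor that each differentiation produces,
  so the induction closes.\<close>

lemma iter_deriv_fexp: "iter_deriv k (\<lambda>x. c * fexp n x) = (\<lambda>x. (\<i> * of_int n) ^ k * (c * fexp n x))"
proof (induction k arbitrary: c)
  case (Suc k)
  have "vector_derivative (\<lambda>x. c * fexp n x) (at x) = (\<i> * of_int n * c) * fexp n x" for x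
    using has_vector_derivative_mult_right[OF fexp_has_vector_derivative, of c n x]
    by (intro vector_derivative_at) (simp add: mult_ac)
  then show ?case
    using Suc[of "\<i> * of_int n * c"] by (simp add: iter_deriv_Suc mult_ac)
qed simp

lemma norm_iter_deriv_fexp: "norm (iter_deriv k (fexp n) x) = \<bar>of_int n\<bar> ^ k"
  using iter_deriv_fexp[of k 1 n] by (simp add: norm_mult norm_power)

lemma test_function_fexp: "test_function (fexp n)"
proof -
  have "(\<lambda>x. (\<i> * of_int n) ^ k * fexp n x) differentiable (at x)" for k x
    using has_vector_derivative_mult_right[OF fexp_has_vector_derivative] differentiableI_vector
    by blast
  then show ?thesis
    using iter_deriv_fexp[of _ 1 n] by (simp add: test_function_def fexp_periodic)
qed


section \<open>Fourier coefficients and distributions\<close>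

text \<open>The coefficient of index \<open>- n\<close>: the transpose of the Fourier coefficient.\<close>

definition test_coeff :: "(real \<Rightarrow> complex) \<Rightarrow> int \<Rightarrow> complex" where
  "test_coeff f n = integral {0..2 * pi} (\<lambda>x. f x * fexp n x) / (2 * pi)"

lemma test_coeff_integrable:
  "test_function f \<Longrightarrow> (\<lambda>x. f x * fexp n x) integrable_on {0..2 * pi}"
  by (intro integrable_continuous_real continuous_intros test_function_continuous_on test_function_fexp)

lemma test_coeff_add:
  assumes "test_function f" "test_function g"
  shows "test_coeff (\<lambda>x. f x + g x) n = test_coeff f n + test_coeff g n"
  unfolding test_coeff_def distrib_right
  by (simp add: integral_add[OF test_coeff_integrable test_coeff_integrable] assms add_divide_distrib)

lemma test_coeff_cmult: "test_coeff (\<lambda>x. c * f x) n = c * test_coeff f n"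
  unfolding test_coeff_def by (simp add: mult.assoc)

text \<open>Integration by parts over a period; the boundary terms cancel by periodicity.\<close>

lemma test_coeff_vector_derivative:
  assumes "test_function f"
  shows "test_coeff (\<lambda>x. vector_derivative f (at x)) n = - \<i> * of_int n * test_coeff f n"
proof -
  let ?f' = "\<lambda>x. vector_derivative f (at x)"
  have "((\<lambda>x. f x * (\<i> * of_int n * fexp n x) + ?f' x * fexp n x) has_integral
      f (2 * pi) * fexp n (2 * pi) - f 0 * fexp n 0) {0..2 * pi}"
    by (intro fundamental_theorem_of_calculus has_vector_derivative_mult
        fexp_has_vector_derivative has_vector_derivative_at_within[OF
          test_function_has_vector_derivative[OF assms]]) auto
  moreover have "f (2 * pi) = f 0" "fexp n (2 * pi) = fexp n 0"
    using test_function_periodic[OF assms, of 0] fexp_periodic[of n 0] by auto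
  ultimately have "integral {0..2 * pi} (\<lambda>x. \<i> * of_int n * (f x * fexp n x) + ?f' x * fexp n x) = 0"
    by (intro integral_unique) (simp add: mult_ac)
  then have "\<i> * of_int n * integral {0..2 * pi} (\<lambda>x. f x * fexp n x)
      + integral {0..2 * pi} (\<lambda>x. ?f' x * fexp n x) = 0"
    by (subst (asm) integral_add)
      (auto intro!: integrable_on_mult_right test_coeff_integrable assms
        test_function_vector_derivative)
  then show ?thesis
    unfolding test_coeff_def by (simp add: field_simps add_eq_0_iff)
qed

lemma test_coeff_iter_deriv:
  "test_function f \<Longrightarrow> test_coeff (iter_deriv k f) n = (- \<i> * of_int n) ^ k * test_coeff f n"
  by (induction k arbitrary: f)
    (simp_all add: iter_deriv_Suc test_function_vector_derivative test_coeff_vector_derivative)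

text \<open>The exponential has modulus one, and the length of the period cancels the
  normalisation.\<close>

lemma norm_test_coeff_le:
  assumes "test_function f"
  shows "norm (test_coeff f n) \<le> (SUP x. norm (f x))"
proof -
  have "norm (integral (cbox 0 (2 * pi)) (\<lambda>x. f x * fexp n x))
      \<le> (SUP x. norm (f x)) * Henstock_Kurzweil_Integration.content (cbox 0 (2 * pi))"
    using norm_test_function_le_SUP[OF assms] test_coeff_integrable[OF assms]
    by (intro has_integral_bound[OF order_trans[OF norm_ge_zero] integrable_integral])
      (auto simp: norm_mult)
  then show ?thesis
    by (simp add: test_coeff_def norm_divide norm_mult field_simps)
qed

text \<open>Expand the power binomially: the term with \<open>\<bar>of_int n\<bar> ^ k\<close> is
  controlled by the \<open>k\<close>-th derivative, and each binomial coefficient is at most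
  \<open>2 ^ M\<close>.\<close>

lemma norm_test_coeff_decay:
  assumes "test_function f"
  shows "norm (test_coeff f n) * (1 + \<bar>of_int n\<bar>) ^ M
    \<le> 2 ^ M * (\<Sum>k\<le>M. SUP x. norm (iter_deriv k f x))"
proof -
  let ?S = "\<lambda>k. SUP x. norm (iter_deriv k f x)"
  have S: "norm (test_coeff f n) * \<bar>of_int n\<bar> ^ k \<le> ?S k" for k
    using norm_test_coeff_le[OF test_function_iter_deriv[OF assms, of k], of n]
    by (simp add: test_coeff_iter_deriv[OF assms] norm_mult norm_power mult.commute)
  have S0: "0 \<le> ?S k" for k
    using S[of k] by (rule order_trans[rotated]) simp
  have "norm (test_coeff f n) * (1 + \<bar>of_int n\<bar>) ^ M
      = (\<Sum>k\<le>M. of_nat (M choose k) * (norm (test_coeff f n) * \<bar>of_int n\<bar> ^ k))"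
    using binomial_ring[of "\<bar>of_int n\<bar>::real" 1 M]
    by (simp add: sum_distrib_left mult_ac add.commute)
  also have "\<dots> \<le> (\<Sum>k\<le>M. 2 ^ M * ?S k)"
  proof (intro sum_mono mult_mono S)
    fix k assume "k \<in> {..M}"
    have "real (M choose k) \<le> real (2 ^ M)"
      using binomial_le_pow2 of_nat_le_iff by blast
    then show "real (M choose k) \<le> 2 ^ M"
      by simp
  qed auto
  finally show ?thesis
    by (simp add: sum_distrib_left)
qed

text \<open>Only \<open>m + n\<close> matters. The constant \<open>fexp 0\<close> has zero
  derivative, so the derivative rule gives \<open>m + n\<close> times the coefficient equal to 0,
  and only \<open>m + n = 0\<close> needs an actual integral.\<close>

lemma test_coeff_fexp: "test_coeff (fexp m) n = (if m + n = 0 then 1 else 0)"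
proof -
  have *: "test_coeff (fexp m) n = test_coeff (fexp 0) (m + n)"
    by (simp add: test_coeff_def fexp_mult)
  have "vector_derivative (fexp 0) (at x) = 0" for x
    using vector_derivative_at[OF fexp_has_vector_derivative[of 0]] by simp
  then have "\<i> * of_int (m + n) * test_coeff (fexp 0) (m + n) = 0"
    using test_coeff_vector_derivative[OF test_function_fexp, of 0 "m + n"]
    by (simp add: test_coeff_def)
  then show ?thesis
    unfolding * using of_int_eq_0_iff[of "m + n", where ?'a = complex]
    by (auto simp del: of_int_add of_int_eq_0_iff simp: test_coeff_def fexp_def scaleR_conv_of_real)
qed

section \<open>Distributions and sequences of polynomial growth\<close>

lemma summable_on_int_inverse_square: "(\<lambda>n::int. 1 / (1 + \<bar>of_int n\<bar>)\<^sup>2 :: real) summable_on UNIV"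
proof -
  have "summable (\<lambda>n. inverse (real (Suc n) ^ 2))"
    by (subst summable_Suc_iff) (rule inverse_power_summable, simp)
  then have nat: "(\<lambda>n::nat. 1 / (1 + real n)\<^sup>2) summable_on UNIV"
    by (subst summable_on_UNIV_nonneg_real_iff) (simp_all add: inverse_eq_divide add.commute)
  have "(\<lambda>n::int. 1 / (1 + \<bar>of_int n\<bar>)\<^sup>2 :: real) summable_on range h"
    if "inj h" "\<And>n. \<bar>h n\<bar> = int n" for h :: "nat \<Rightarrow> int"
  proof -
    have "\<bar>real_of_int (h n)\<bar> = real n" for n
      using that(2)[of n] by (metis of_int_abs of_int_of_nat_eq)
    then show ?thesis
      using nat by (simp add: summable_on_reindex[OF that(1)] o_def)
  qed
  \<comment> \<open>The two half-lines overlap at 0, which is harmless for summability on their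
    union.\<close>
  from this[of int] this[of "\<lambda>n. - int n"]
  have "(\<lambda>n::int. 1 / (1 + \<bar>of_int n\<bar>)\<^sup>2 :: real) summable_on (range int \<union> range (\<lambda>n. - int n))"
    by (intro summable_on_union) (auto simp: inj_on_def)
  moreover have "range int \<union> range (\<lambda>n. - int n) = UNIV"
    by (auto simp: image_iff) (metis int_cases2)
  ultimately show ?thesis
    by simp
qed

text \<open>Test the continuity estimate on exponentials, whose \<open>k\<close>-th derivative has
  constant modulus \<open>\<bar>of_int n\<bar> ^ k\<close>.\<close>

lemma fourier_polynomial_growth:
  assumes "periodic_distribution w"
  shows "\<exists>C N. \<forall>n. norm (fourier w n) \<le> C * (1 + \<bar>of_int n\<bar>) ^ N"
proof -
  obtain N C where C: "\<And>f. test_function f \<Longrightarrow>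
      norm (w f) \<le> C * (\<Sum>k\<le>N. SUP x. norm (iter_deriv k f x))"
    using assms unfolding periodic_distribution_def by blast
  have "norm (fourier w n) \<le> (\<bar>C\<bar> * real (Suc N)) * (1 + \<bar>of_int n\<bar>) ^ N" for n
  proof -
    have "norm (fourier w n) \<le> C * (\<Sum>k\<le>N. \<bar>of_int n\<bar> ^ k)"
      using C[OF test_function_fexp, of "- n"]
      by (simp add: pairing_def cnj_fexp norm_iter_deriv_fexp)
    \<comment> \<open>The definition of a distribution does not fix the sign of
      \<open>C\<close>.\<close>
    also have "\<dots> \<le> \<bar>C\<bar> * (\<Sum>k\<le>N. \<bar>of_int n\<bar> ^ k)"
      by (intro mult_right_mono sum_nonneg) auto
    also have "\<dots> \<le> \<bar>C\<bar> * (\<Sum>k\<le>N. (1 + \<bar>of_int n\<bar>) ^ N)"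
    proof (intro mult_left_mono sum_mono)
      fix k assume "k \<in> {..N}"
      \<comment> \<open>The base is first raised to at least 1, since powers of 0 do not increase
        with the exponent.\<close>
      have "\<bar>of_int n\<bar> ^ k \<le> (1 + \<bar>real_of_int n\<bar>) ^ k"
        by (intro power_mono) auto
      also have "\<dots> \<le> (1 + \<bar>of_int n\<bar>) ^ N"
        using \<open>k \<in> {..N}\<close> by (intro power_increasing) auto
      finally show "\<bar>of_int n\<bar> ^ k \<le> (1 + \<bar>real_of_int n\<bar>) ^ N" .
    qed simp
    finally show ?thesis
      by simp
  qed
  then show ?thesis
    by blast
qed

text \<open>The functional is the Parseval series of \<open>b\<close> against the coefficients of
  the test function. One estimate gives both its convergence and its continuity.\<close>

lemma distribution_of_fourier_coefficients:
  fixes b :: "int \<Rightarrow> complex"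
  assumes b: "\<And>n. norm (b n) \<le> C * (1 + \<bar>of_int n\<bar>) ^ N"
  shows "\<exists>w. periodic_distribution w \<and> (\<forall>n. fourier w n = b n)"
proof -
  define w where "w f = (\<Sum>\<^sub>\<infinity>n. b n * test_coeff f n)" for f
  define q :: "int \<Rightarrow> real" where "q n = 1 / (1 + \<bar>of_int n\<bar>)\<^sup>2" for n :: int
  note q = summable_on_int_inverse_square[folded q_def]
  \<comment> \<open>Two orders of decay beyond the growth \<open>N\<close> leave the summable weight
    \<open>q\<close>.\<close>
  define D where "D f = 2 ^ (N + 2) * (\<Sum>k\<le>N + 2. SUP x. norm (iter_deriv k f x))" for f
  have C0: "0 \<le> C"
    using order_trans[OF norm_ge_zero b[of 0]] by simp
  have summand_le: "norm (b n * test_coeff f n) \<le> C * D f * q n" if "test_function f" for f n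
  proof -
    have power: "(1 + \<bar>real_of_int n\<bar>) ^ N = (1 + \<bar>of_int n\<bar>) ^ (N + 2) * q n"
      unfolding q_def power_add using abs_ge_zero[of "real_of_int n"] by auto
    have "norm (b n * test_coeff f n) \<le> C * (1 + \<bar>of_int n\<bar>) ^ N * norm (test_coeff f n)"
      using b[of n] by (simp add: norm_mult mult_right_mono)
    also have "\<dots> = C * (norm (test_coeff f n) * (1 + \<bar>of_int n\<bar>) ^ (N + 2)) * q n"
      unfolding power by (simp only: mult_ac)
    also have "\<dots> \<le> C * D f * q n"
      using norm_test_coeff_decay[OF that, of n "N + 2"] C0
      by (intro mult_right_mono mult_left_mono) (auto simp: D_def q_def)
    finally show ?thesis .
  qed
  have abs_summable: "(\<lambda>n. norm (b n * test_coeff f n)) summable_on UNIV" if "test_function f" for f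
    by (rule summable_on_comparison_test[OF summable_on_cmult_right[OF q]])
      (use summand_le[OF that] in auto)
  note summable = abs_summable[THEN abs_summable_summable]
  have "periodic_distribution w"
    unfolding periodic_distribution_def
  proof (intro conjI allI impI exI)
    fix f g assume fg: "test_function f" "test_function g"
    then show "w (\<lambda>x. f x + g x) = w f + w g"
      by (simp add: w_def test_coeff_add distrib_left infsum_add summable)
  next
    fix c f assume "test_function f"
    have "w (\<lambda>x. c * f x) = (\<Sum>\<^sub>\<infinity>n. c * (b n * test_coeff f n))"
      by (simp add: w_def test_coeff_cmult mult_ac)
    then show "w (\<lambda>x. c * f x) = c * w f"
      by (simp add: w_def infsum_cmult_right')
  next
    fix f assume f: "test_function f"
    have "norm (w f) \<le> (\<Sum>\<^sub>\<infinity>n. norm (b n * test_coeff f n))"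
      unfolding w_def by (rule norm_infsum_bound[OF abs_summable[OF f]])
    also have "\<dots> \<le> (\<Sum>\<^sub>\<infinity>n. C * D f * q n)"
      by (intro infsum_mono abs_summable f summable_on_cmult_right q summand_le)
    also have "\<dots> = C * D f * infsum q UNIV"
      by (simp add: infsum_cmult_right')
    finally show "norm (w f) \<le>
        (C * 2 ^ (N + 2) * infsum q UNIV) * (\<Sum>k\<le>N + 2. SUP x. norm (iter_deriv k f x))"
      by (simp add: D_def mult_ac)
  qed
  moreover have "fourier w n = b n" for n
  proof -
    have "fourier w n = (\<Sum>\<^sub>\<infinity>m. b m * test_coeff (fexp (- n)) m)"
      by (simp add: pairing_def cnj_fexp w_def)
    \<comment> \<open>Orthogonality of the exponentials kills every term but
      \<open>m = n\<close>.\<close>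
    also have "\<dots> = (\<Sum>\<^sub>\<infinity>m\<in>{n}. b m)"
      by (rule infsum_cong_neutral) (auto simp: test_coeff_fexp)
    finally show ?thesis
      by simp
  qed
  ultimately show ?thesis
    by blast
qed


section \<open>The reachable states on a pair of modes\<close>

definition duhamel :: "int \<Rightarrow> (real \<Rightarrow> real) \<Rightarrow> real \<Rightarrow> real" where
  "duhamel n v t = (LINT s|lebesgue_on {0<..<t}. exp (- (of_int n)\<^sup>2 * (t - s)) * v s)"

lemma duhamel_uminus: "duhamel (- n) v t = duhamel n v t"
  by (simp add: duhamel_def)

lemma integrable_heat_kernel:
  fixes t :: real
  shows "integrable (lebesgue_on {0<..<t}) (\<lambda>s. exp (- (of_int n)\<^sup>2 * (t - s)))"
proof -
  interpret finite_measure "lebesgue_on {0<..<t}"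
    by (rule finite_measure_lebesgue_on) simp
  show ?thesis
  proof (rule integrable_const_bound[where B = 1])
    show "(\<lambda>s. exp (- (of_int n)\<^sup>2 * (t - s))) \<in> borel_measurable (lebesgue_on {0<..<t})"
      by (intro continuous_imp_measurable_on_sets_lebesgue continuous_intros) auto
  qed (auto intro!: AE_I2)
qed

lemma integrable_const_interval: "integrable (lebesgue_on {0<..<t::real}) (\<lambda>s. c :: real)"
  by (intro finite_measure.integrable_const finite_measure_lebesgue_on) auto

lemma integral_const_interval:
  "0 \<le> t \<Longrightarrow> (LINT s|lebesgue_on {0<..<t::real}. c :: real) = c * t"
  by (simp add: measure_restrict_space space_restrict_space)

lemma duhamel_const: "duhamel n (\<lambda>s. c) t = c * duhamel n (\<lambda>s. 1) t"
  by (simp add: duhamel_def mult.commute)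

text \<open>On the interval the kernel is at least its value at \<open>s = 0\<close>, a positive
  constant. Positivity later permits division by this factor.\<close>

lemma duhamel_one_pos:
  assumes "0 < t"
  shows "0 < duhamel n (\<lambda>s. 1) t"
proof -
  have "0 < exp (- (of_int n)\<^sup>2 * t) * t"
    using assms by simp
  also have "\<dots> = (LINT s|lebesgue_on {0<..<t}. exp (- (of_int n)\<^sup>2 * t))"
    using assms by (intro integral_const_interval[symmetric]) simp
  also have "\<dots> \<le> (LINT s|lebesgue_on {0<..<t}. exp (- (of_int n)\<^sup>2 * (t - s)))"
    by (intro integral_mono integrable_heat_kernel integrable_const_interval)
      (auto intro!: mult_left_mono)
  finally show ?thesis
    by (simp add: duhamel_def)
qed

text \<open>The kernel is at most 1. The bound is uniform in \<open>n\<close>, so multiplying by the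
  factor preserves polynomial growth of coefficients.\<close>

lemma duhamel_one_le:
  assumes "0 \<le> t"
  shows "duhamel n (\<lambda>s. 1) t \<le> t"
proof -
  have "(LINT s|lebesgue_on {0<..<t}. exp (- (of_int n)\<^sup>2 * (t - s)))
      \<le> (LINT s|lebesgue_on {0<..<t}. 1)"
    by (intro integral_mono integrable_heat_kernel integrable_const_interval) auto
  then show ?thesis
    using assms integral_const_interval[of t 1] by (simp add: duhamel_def)
qed

section \<open>Solutions under constant controls, and the reachable line\<close>

lemma const_control: "(\<lambda>s. c) \<in> controls T"
  by (simp add: controls_def integrable_const_interval)

text \<open>A solution must be a distribution at each time, so one is built time by time from
  coefficients that grow no faster than those of \<open>\<phi>\<close>.\<close>

lemma heat_solution_const_control:
  assumes "periodic_distribution \<phi>"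
  shows "\<exists>u. heat_solution T \<phi> (\<lambda>s. c) (\<lambda>f. 0) u"
proof -
  obtain C N where CN: "\<And>n. norm (fourier \<phi> n) \<le> C * (1 + \<bar>of_int n\<bar>) ^ N"
    using fourier_polynomial_growth[OF assms] by blast
  have "\<exists>w. periodic_distribution w \<and>
      (\<forall>n. fourier w n = fourier \<phi> n * of_real (duhamel n (\<lambda>s. c) t))" if t: "0 \<le> t" for t
  proof (rule distribution_of_fourier_coefficients)
    fix n
    have "\<bar>duhamel n (\<lambda>s. 1) t\<bar> \<le> t"
      using t duhamel_one_le[of t n] duhamel_one_pos[of t n]
      \<comment> \<open>Positivity needs \<open>0 < t\<close>; at \<open>t = 0\<close> the integral
        runs over the empty interval and is 0.\<close>
      by (cases "t = 0") (auto simp: duhamel_def)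
    then have "\<bar>duhamel n (\<lambda>s. c) t\<bar> \<le> \<bar>c\<bar> * t"
      by (subst duhamel_const) (simp add: abs_mult mult_left_mono)
    then show "norm (fourier \<phi> n * of_real (duhamel n (\<lambda>s. c) t))
        \<le> (C * (\<bar>c\<bar> * t)) * (1 + \<bar>of_int n\<bar>) ^ N"
      using mult_mono[OF CN[of n], of "\<bar>duhamel n (\<lambda>s. c) t\<bar>" "\<bar>c\<bar> * t"]
        order_trans[OF norm_ge_zero CN[of n]]
      by (simp add: norm_mult mult_ac)
  qed
  then obtain u where "\<And>t. 0 \<le> t \<Longrightarrow> periodic_distribution (u t) \<and>
      (\<forall>n. fourier (u t) n = fourier \<phi> n * of_real (duhamel n (\<lambda>s. c) t))"
    by metis
  then have "heat_solution T \<phi> (\<lambda>s. c) (\<lambda>f. 0) u"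
    by (simp add: heat_solution_def duhamel_def pairing_def)
  then show ?thesis
    by blast
qed

text \<open>A single \<open>v\<close> serves all modes, so the factors of \<open>n\<close> and
  \<open>- n\<close> can be compared.\<close>

lemma fourier_reachable:
  assumes "0 \<le> T" "w \<in> reachable_from_zero T \<phi>"
  obtains v where "\<And>n. fourier w n = fourier \<phi> n * of_real (duhamel n v T)"
proof -
  obtain u v where "w = u T" "heat_solution T \<phi> v (\<lambda>f. 0) u"
    using assms(2) unfolding reachable_from_zero_def by blast
  then have "fourier w n = fourier \<phi> n * of_real (duhamel n v T)" for n
    using assms(1) by (simp add: heat_solution_def duhamel_def pairing_def)
  then show ?thesis
    by (rule that)
qed

lemma mode_projection_reachable:
  assumes "0 < T" "periodic_distribution \<phi>"
  shows "mode_projection n ` reachable_from_zero T \<phi> =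
    range (\<lambda>r. scale_real r (mode_projection n \<phi>))" (is "?P = ?R")
proof
  show "?P \<subseteq> ?R"
  proof clarify
    fix w assume "w \<in> reachable_from_zero T \<phi>"
    then obtain v where v: "\<And>n. fourier w n = fourier \<phi> n * of_real (duhamel n v T)"
      using fourier_reachable assms(1) by (metis less_imp_le)
    have "mode_projection n w = scale_real (duhamel n v T) (mode_projection n \<phi>)"
      by (simp add: mode_projection_def v duhamel_uminus fun_eq_iff algebra_simps)
    then show "mode_projection n w \<in> ?R"
      by blast
  qed
  show "?R \<subseteq> ?P"
  proof clarify
    fix r :: real
    \<comment> \<open>The factor is linear in a constant control, so this constant tunes it to
      \<open>r\<close> on both modes \<open>n\<close> and \<open>- n\<close>.\<close>
    define c where "c = r / duhamel n (\<lambda>s. 1) T"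
    have c: "duhamel n (\<lambda>s. c) T = r"
      using duhamel_one_pos[OF assms(1), of n] by (subst duhamel_const) (simp add: c_def)
    obtain u where u: "heat_solution T \<phi> (\<lambda>s. c) (\<lambda>f. 0) u"
      using heat_solution_const_control[OF assms(2)] by blast
    then have "fourier (u T) m = fourier \<phi> m * of_real (duhamel m (\<lambda>s. c) T)" for m
      using assms(1) by (simp add: heat_solution_def duhamel_def pairing_def)
    then have "mode_projection n (u T) = scale_real r (mode_projection n \<phi>)"
      by (simp add: mode_projection_def duhamel_uminus c fun_eq_iff algebra_simps)
    moreover have "u T \<in> reachable_from_zero T \<phi>"
      using u const_control unfolding reachable_from_zero_def by blast
    ultimately show "scale_real r (mode_projection n \<phi>) \<in> ?P"
      by (metis imageI)
  qed
qed

section \<open>Dimensions over the real and the complex scalars\<close>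

interpretation real_functions: vector_space scale_real
  by unfold_locales (auto simp: fun_eq_iff algebra_simps)

interpretation complex_functions: vector_space scale_complex
  by unfold_locales (auto simp: fun_eq_iff algebra_simps)

text \<open>Evaluation at 0 gives \<open>a + b = 0\<close>; at a quarter of the period of
  \<open>fexp n\<close> the exponentials are \<open>\<i>\<close> and \<open>- \<i>\<close>, giving
  \<open>a - b = 0\<close>.\<close>

lemma fexp_combination_eq_0:
  assumes "n \<noteq> 0" and "\<And>x. a * fexp n x + b * fexp (- n) x = 0"
  shows "a = 0"
proof -
  have "fexp n (pi / (2 * of_int n)) = \<i>" "fexp (- n) (pi / (2 * of_int n)) = - \<i>"
    using assms(1) by (simp_all add: fexp_def exp_minus exp_eq_polar cis_conv_exp[symmetric] mult_ac)
  then have "a - b = 0"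
    using assms(2)[of "pi / (2 * of_int n)"] by (simp add: algebra_simps)
  moreover have "a + b = 0"
    using assms(2)[of 0] by (simp add: fexp_def)
  ultimately show ?thesis
    by simp
qed

lemma dim_mode_space:
  assumes "n \<noteq> 0"
  shows "complex_functions.dim (mode_space n) = 2"
proof -
  have notin: "fexp n \<notin> complex_functions.span {fexp (- n)}"
  proof
    assume "fexp n \<in> complex_functions.span {fexp (- n)}"
    then obtain c where "fexp n = scale_complex c (fexp (- n))"
      unfolding complex_functions.span_singleton by blast
    then have "1 * fexp n x + (- c) * fexp (- n) x = 0" for x
      by (simp add: fun_eq_iff)
    from fexp_combination_eq_0[OF assms this] show False
      by simp
  qed
  have "fexp (- n) 0 \<noteq> 0"
    by (simp add: fexp_def)
  then have "fexp (- n) \<noteq> 0"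
    by (metis zero_fun_apply)
  then have "complex_functions.independent {fexp n, fexp (- n)}"
    using notin by (intro complex_functions.independent_insertI complex_functions.independent_empty) auto
  moreover have "fexp n \<noteq> fexp (- n)"
    using notin by (metis complex_functions.span_base singletonI)
  ultimately show ?thesis
    unfolding mode_space_def
    by (simp add: complex_functions.dim_eq_card_independent)
qed

lemma mode_projection_in_mode_space: "mode_projection n w \<in> mode_space n"
proof -
  have "scale_complex (fourier w n) (fexp n) + scale_complex (fourier w (- n)) (fexp (- n))
      \<in> mode_space n"
    unfolding mode_space_def
    by (intro complex_functions.span_add complex_functions.span_scale complex_functions.span_base) auto
  then show ?thesis
    by (simp add: mode_projection_def plus_fun_def)
qed

theorem mainTheorem3:
  fixes T \<sigma> :: real and \<phi> :: dist
  assumes "T > 0" and "\<phi> \<in> sobolev_real \<sigma>"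
  shows
    "(\<forall>n0::int. fourier \<phi> n0 = 0 \<longrightarrow>
        (\<forall>u0 v u. periodic_distribution u0 \<longrightarrow> v \<in> controls T \<longrightarrow> heat_solution T \<phi> v u0 u \<longrightarrow>
           fourier (u T) n0 = of_real (exp (- (of_int n0)\<^sup>2 * T)) * fourier u0 n0)) \<and>
     ((\<forall>n::int. fourier \<phi> n \<noteq> 0) \<longrightarrow>
        (let d = (\<lambda>n. fourier \<phi> n / fourier \<phi> (- n)) in
           \<forall>w\<in>reachable_from_zero T \<phi>. \<forall>n\<ge>1. fourier w n = d n * fourier w (- n)) \<and>
        (\<forall>n\<ge>1. let P = mode_projection n ` reachable_from_zero T \<phi> in
           vector_space.dim scale_complex (mode_space n) = 2 \<and>
           P \<subseteq> mode_space n \<and>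
           module.subspace scale_real P \<and>
           vector_space.dim scale_real P = 1 \<and>
           vector_space.dim scale_complex P = 1))"
proof (intro conjI allI impI)
  fix n0 u0 v u
  assume "fourier \<phi> n0 = 0" "heat_solution T \<phi> v u0 u"
  then show "fourier (u T) n0 = of_real (exp (- (of_int n0)\<^sup>2 * T)) * fourier u0 n0"
    using assms(1) by (simp add: heat_solution_def)
next
  assume nz: "\<forall>n::int. fourier \<phi> n \<noteq> 0"
  \<comment> \<open>Both coefficients of \<open>w\<close> carry the same Duhamel factor, which thus
    drops out of the relation.\<close>
  have "fourier w n = fourier \<phi> n / fourier \<phi> (- n) * fourier w (- n)"
    if "w \<in> reachable_from_zero T \<phi>" for w n
  proof -
    obtain v where "\<And>n. fourier w n = fourier \<phi> n * of_real (duhamel n v T)"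
      using fourier_reachable assms(1) \<open>w \<in> _\<close> by (metis less_imp_le)
    then show ?thesis
      using nz by (simp add: duhamel_uminus)
  qed
  then show "let d = (\<lambda>n. fourier \<phi> n / fourier \<phi> (- n)) in
      \<forall>w\<in>reachable_from_zero T \<phi>. \<forall>n\<ge>1. fourier w n = d n * fourier w (- n)"
    unfolding Let_def by blast
next
  fix n :: int
  assume nz: "\<forall>n::int. fourier \<phi> n \<noteq> 0" and "1 \<le> n"
  define e where "e = mode_projection n \<phi>"
  have "periodic_distribution \<phi>"
    using assms(2) by (simp add: sobolev_real_def real_distribution_def)
  \<comment> \<open>The projection is exactly a real line, so the subspace claim and both dimensions
    reduce to facts about \<open>e\<close>.\<close>
  then have P: "mode_projection n ` reachable_from_zero T \<phi> = real_functions.span {e}"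
    unfolding real_functions.span_singleton e_def using assms(1)
    by (intro mode_projection_reachable)
  \<comment> \<open>This excludes dimension 0. Here \<open>1 \<le> n\<close> matters: for
    \<open>n = 0\<close> the two exponentials coincide.\<close>
  have "e \<noteq> 0"
  proof
    assume "e = 0"
    then have "fourier \<phi> n * fexp n x + fourier \<phi> (- n) * fexp (- n) x = 0" for x
      by (simp add: e_def mode_projection_def fun_eq_iff)
    then have "fourier \<phi> n = 0"
      using \<open>1 \<le> n\<close> fexp_combination_eq_0[of n] by fastforce
    then show False
      using nz by simp
  qed
  then have "real_functions.dim (real_functions.span {e}) = 1"
    by (simp add: real_functions.dim_eq_card_independent)
  \<comment> \<open>The real line is not a complex subspace, but \<open>dim\<close> of a set is that
    of its span: \<open>{e}\<close> is independent, lies in the line and spans it over the complex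
    numbers.\<close>
  moreover have "complex_functions.dim (real_functions.span {e}) = 1"
  proof (rule complex_functions.dim_unique[of "{e}"])
    show "real_functions.span {e} \<subseteq> complex_functions.span {e}"
      unfolding real_functions.span_singleton complex_functions.span_singleton by auto
  qed (use \<open>e \<noteq> 0\<close> in \<open>auto intro: real_functions.span_base\<close>)
  moreover have "mode_projection n ` reachable_from_zero T \<phi> \<subseteq> mode_space n"
    using mode_projection_in_mode_space by blast
  ultimately show "let P = mode_projection n ` reachable_from_zero T \<phi> in
      vector_space.dim scale_complex (mode_space n) = 2 \<and>
      P \<subseteq> mode_space n \<and>
      module.subspace scale_real P \<and>
      vector_space.dim scale_real P = 1 \<and>
      vector_space.dim scale_complex P = 1"
    using dim_mode_space[of n] \<open>1 \<le> n\<close> real_functions.subspace_span[of "{e}"]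
    by (simp add: Let_def P)
qed

end
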